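(* Let $(\mathcal{C},S)$ and $(\mathcal{C}',S')$ be two pointed $(4,3)$-white-categories, and assume that $(\mathcal{C}',S')$ is stronger than $(\mathcal{C},S)$. If $\mathcal{C}'$ is $S'$-coherent, then $\mathcal{C}$ is $S$-coherent.
   Context: **White-categories.** For $n\in\mathbb{N}$, an $(n+1)$-white-category $\mathcal{C}$ consists of: a set $\mathcal{C}_0$; for all $x,y\in\mathcal{C}_0$ a strict $n$-category $\mathcal{C}(x,y)$, whose $k$-cells are the $(k+1)$-cells of $\mathcal{C}$ and whose $k$-composition is written $\star_{k+1}$; for every $1$-cell $u:x\to y$ (i.e. $0$-cell of $\mathcal{C}(x,y)$) and $z\in\mathcal{C}_0$, functors $u\star_0-:\mathcal{C}(y,z)\to\mathcal{C}(x,z)$ and $-\star_0 u:\mathcal{C}(z,x)\to\mathcal{C}(z,y)$, agreeing on $1$-cells so that $u\star_0 v$ is unambiguous; and $1$-cells $1_x\in\mathcal{C}(x,x)$; such that $1_x\star_0-$ and $-\star_0 1_y$ are identities and $u\star_0(v\star_0-)=(u\star_0v)\star_0-$, $u\star_0(-\star_0v)=(u\star_0-)\star_0v$, $-\star_0(u\star_0v)=(-\star_0u)\star_0v$. A $(4,3)$-white-category is a $4$-white-category in which every $4$-cell is invertible for $\star_3$. $\mathcal{C}_k$ denotes the set of $k$-cells. **Pointed white-categories.** A pointed $(4,3)$-white-category is a pair $(\mathcal{C},S)$ with $\mathcal{C}$ a $(4,3)$-white-category and $S\subseteq\mathcal{C}_2$. The restriction $\mathcal{C}\restriction S$ is the $(2,1)$-category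 (a $2$-category with invertible $2$-cells) whose $0$-cells are the elements of $S$, whose $1$-cells are the $3$-cells of $\mathcal{C}$ with source and target in $S$, whose $2$-cells are the $4$-cells of $\mathcal{C}$ with $2$-source and $2$-target in $S$, and whose $0$- and $1$-compositions are induced by $\star_2$ and $\star_3$. $\mathcal{C}$ is $S$-coherent if for all parallel $1$-cells $A,B$ of $\mathcal{C}\restriction S$ there is a $2$-cell $A\Rightarrow B$ in $\mathcal{C}\restriction S$. For a $(2,1)$-category $\mathcal{K}$, $\overline{\mathcal{K}}$ denotes the category obtained by identifying $1$-cells connected by a $2$-cell. $(\mathcal{C}',S')$ is stronger than $(\mathcal{C},S)$ if there is a functor $F:\overline{\mathcal{C}'\restriction S'}\to\overline{\mathcal{C}\restriction S}$ that is $0$-surjective (surjective on objects) and $1$-surjective (for all objects $s,t$ the map $\mathrm{Hom}(s,t)\to\mathrm{Hom}(F(s),F(t))$ is surjective). *)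

theory Defs
  imports Main
begin

section \<open>Strict n-categories\<close>

text \<open>
  All operations carry the dimension of their arguments: \<open>Src K k\<close> and \<open>Tgt K k\<close> send
  (k+1)-cells to k-cells, \<open>Idn K k\<close> sends k-cells to (k+1)-cells, and \<open>Comp K k m f g\<close>
  is the composite of the m-cells \<open>f\<close> and \<open>g\<close> along their common k-cell, in diagrammatic
  order. A value of the type \<open>'a\<close> may therefore be a cell in several dimensions at once,
  and nothing is required outside the carrier sets.
\<close>

record 'a ncat =
  Cell :: "nat \<Rightarrow> 'a set"
  Src :: "nat \<Rightarrow> 'a \<Rightarrow> 'a"
  Tgt :: "nat \<Rightarrow> 'a \<Rightarrow> 'a"
  Idn :: "nat \<Rightarrow> 'a \<Rightarrow> 'a"
  Comp :: "nat \<Rightarrow> nat \<Rightarrow> 'a \<Rightarrow> 'a \<Rightarrow> 'a"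

text \<open>
  For an m-cell \<open>f\<close> and \<open>k \<le> m\<close>, \<open>ksrc K k m f\<close> and \<open>ktgt K k m f\<close> are its k-source and
  k-target; for a k-cell \<open>f\<close>, \<open>kid K k m f\<close> is the iterated identity m-cell on it.
\<close>

primrec ksrc :: "('a, 'r) ncat_scheme \<Rightarrow> nat \<Rightarrow> nat \<Rightarrow> 'a \<Rightarrow> 'a" where
  "ksrc K k 0 f = f"
| "ksrc K k (Suc m) f = (if k \<le> m then ksrc K k m (Src K m f) else f)"

primrec ktgt :: "('a, 'r) ncat_scheme \<Rightarrow> nat \<Rightarrow> nat \<Rightarrow> 'a \<Rightarrow> 'a" where
  "ktgt K k 0 f = f"
| "ktgt K k (Suc m) f = (if k \<le> m then ktgt K k m (Tgt K m f) else f)"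

primrec kid :: "('a, 'r) ncat_scheme \<Rightarrow> nat \<Rightarrow> nat \<Rightarrow> 'a \<Rightarrow> 'a" where
  "kid K k 0 f = f"
| "kid K k (Suc m) f = (if k \<le> m then Idn K m (kid K k m f) else f)"

definition composable :: "('a, 'r) ncat_scheme \<Rightarrow> nat \<Rightarrow> nat \<Rightarrow> 'a \<Rightarrow> 'a \<Rightarrow> bool" where
  "composable K k m f g \<longleftrightarrow> f \<in> Cell K m \<and> g \<in> Cell K m \<and> ktgt K k m f = ksrc K k m g"

locale strict_ncategory =
  fixes n :: nat and K :: "('a, 'r) ncat_scheme"
  assumes src_cell: "\<lbrakk>k < n; f \<in> Cell K (Suc k)\<rbrakk> \<Longrightarrow> Src K k f \<in> Cell K k"
    and tgt_cell: "\<lbrakk>k < n; f \<in> Cell K (Suc k)\<rbrakk> \<Longrightarrow> Tgt K k f \<in> Cell K k"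
    and globular_src: "\<lbrakk>Suc k < n; f \<in> Cell K (Suc (Suc k))\<rbrakk>
          \<Longrightarrow> Src K k (Src K (Suc k) f) = Src K k (Tgt K (Suc k) f)"
    and globular_tgt: "\<lbrakk>Suc k < n; f \<in> Cell K (Suc (Suc k))\<rbrakk>
          \<Longrightarrow> Tgt K k (Src K (Suc k) f) = Tgt K k (Tgt K (Suc k) f)"
    and id_cell: "\<lbrakk>k < n; f \<in> Cell K k\<rbrakk> \<Longrightarrow> Idn K k f \<in> Cell K (Suc k)"
    and src_id: "\<lbrakk>k < n; f \<in> Cell K k\<rbrakk> \<Longrightarrow> Src K k (Idn K k f) = f"
    and tgt_id: "\<lbrakk>k < n; f \<in> Cell K k\<rbrakk> \<Longrightarrow> Tgt K k (Idn K k f) = f"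
    and comp_cell: "\<lbrakk>k < m; m \<le> n; composable K k m f g\<rbrakk> \<Longrightarrow> Comp K k m f g \<in> Cell K m"
    and src_comp_top: "\<lbrakk>m < n; composable K m (Suc m) f g\<rbrakk>
          \<Longrightarrow> Src K m (Comp K m (Suc m) f g) = Src K m f"
    and tgt_comp_top: "\<lbrakk>m < n; composable K m (Suc m) f g\<rbrakk>
          \<Longrightarrow> Tgt K m (Comp K m (Suc m) f g) = Tgt K m g"
    and src_comp: "\<lbrakk>k < m; m < n; composable K k (Suc m) f g\<rbrakk>
          \<Longrightarrow> Src K m (Comp K k (Suc m) f g) = Comp K k m (Src K m f) (Src K m g)"
    and tgt_comp: "\<lbrakk>k < m; m < n; composable K k (Suc m) f g\<rbrakk>
          \<Longrightarrow> Tgt K m (Comp K k (Suc m) f g) = Comp K k m (Tgt K m f) (Tgt K m g)"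
    and comp_assoc: "\<lbrakk>k < m; m \<le> n; composable K k m f g; composable K k m g h\<rbrakk>
          \<Longrightarrow> Comp K k m (Comp K k m f g) h = Comp K k m f (Comp K k m g h)"
    and id_comp_left: "\<lbrakk>k < m; m \<le> n; f \<in> Cell K m\<rbrakk>
          \<Longrightarrow> Comp K k m (kid K k m (ksrc K k m f)) f = f"
    and id_comp_right: "\<lbrakk>k < m; m \<le> n; f \<in> Cell K m\<rbrakk>
          \<Longrightarrow> Comp K k m f (kid K k m (ktgt K k m f)) = f"
    and interchange: "\<lbrakk>j < k; k < m; m \<le> n; composable K k m f g; composable K k m f' g';
             composable K j m f f'; composable K j m g g'\<rbrakk>
          \<Longrightarrow> Comp K j m (Comp K k m f g) (Comp K k m f' g')
              = Comp K k m (Comp K j m f f') (Comp K j m g g')"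
    and id_comp: "\<lbrakk>k < m; m < n; composable K k m f g\<rbrakk>
          \<Longrightarrow> Idn K m (Comp K k m f g) = Comp K k (Suc m) (Idn K m f) (Idn K m g)"

text \<open>Every (m+1)-cell is invertible for the m-composition.\<close>

definition invertible_cells :: "nat \<Rightarrow> ('a, 'r) ncat_scheme \<Rightarrow> bool" where
  "invertible_cells m K \<longleftrightarrow>
     (\<forall>f \<in> Cell K (Suc m). \<exists>g \<in> Cell K (Suc m).
        Src K m g = Tgt K m f \<and> Tgt K m g = Src K m f \<and>
        Comp K m (Suc m) f g = Idn K m (Src K m f) \<and>
        Comp K m (Suc m) g f = Idn K m (Tgt K m f))"

definition two_one_category :: "('a, 'r) ncat_scheme \<Rightarrow> bool" where
  "two_one_category K \<longleftrightarrow> strict_ncategory 2 K \<and> invertible_cells 1 K"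

locale strict_nfunctor =
  source: strict_ncategory n K + target: strict_ncategory n L
  for n :: nat and K :: "('a, 'r) ncat_scheme" and L :: "('b, 's) ncat_scheme" +
  fixes F :: "nat \<Rightarrow> 'a \<Rightarrow> 'b"
  assumes map_cell: "\<lbrakk>k \<le> n; f \<in> Cell K k\<rbrakk> \<Longrightarrow> F k f \<in> Cell L k"
    and map_src: "\<lbrakk>k < n; f \<in> Cell K (Suc k)\<rbrakk> \<Longrightarrow> F k (Src K k f) = Src L k (F (Suc k) f)"
    and map_tgt: "\<lbrakk>k < n; f \<in> Cell K (Suc k)\<rbrakk> \<Longrightarrow> F k (Tgt K k f) = Tgt L k (F (Suc k) f)"
    and map_id: "\<lbrakk>k < n; f \<in> Cell K k\<rbrakk> \<Longrightarrow> F (Suc k) (Idn K k f) = Idn L k (F k f)"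
    and map_comp: "\<lbrakk>k < m; m \<le> n; composable K k m f g\<rbrakk>
          \<Longrightarrow> F m (Comp K k m f g) = Comp L k m (F m f) (F m g)"


section \<open>White-categories\<close>

text \<open>
  For 1-cells \<open>u : x \<rightarrow> y\<close>, \<open>LWhisk C x y z u\<close> is the functor \<open>u \<star>\<^sub>0 - : C(y,z) \<rightarrow> C(x,z)\<close> and
  \<open>RWhisk C z x y u\<close> is the functor \<open>- \<star>\<^sub>0 u : C(z,x) \<rightarrow> C(z,y)\<close>. Their further natural number
  argument is the dimension in the hom-category of the cell they are applied to.
\<close>

record ('o, 'a) white_cat =
  Obj :: "'o set"
  Hom :: "'o \<Rightarrow> 'o \<Rightarrow> 'a ncat"
  LWhisk :: "'o \<Rightarrow> 'o \<Rightarrow> 'o \<Rightarrow> 'a \<Rightarrow> nat \<Rightarrow> 'a \<Rightarrow> 'a"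
  RWhisk :: "'o \<Rightarrow> 'o \<Rightarrow> 'o \<Rightarrow> 'a \<Rightarrow> nat \<Rightarrow> 'a \<Rightarrow> 'a"
  Unit :: "'o \<Rightarrow> 'a"

text \<open>The locale describes (n+1)-white-categories.\<close>

locale white_category =
  fixes n :: nat and C :: "('o, 'a, 'r) white_cat_scheme"
  assumes hom_category:
      "\<lbrakk>x \<in> Obj C; y \<in> Obj C\<rbrakk> \<Longrightarrow> strict_ncategory n (Hom C x y)"
    and lwhisk_functor:
      "\<lbrakk>x \<in> Obj C; y \<in> Obj C; z \<in> Obj C; u \<in> Cell (Hom C x y) 0\<rbrakk>
       \<Longrightarrow> strict_nfunctor n (Hom C y z) (Hom C x z) (LWhisk C x y z u)"
    and rwhisk_functor:
      "\<lbrakk>z \<in> Obj C; x \<in> Obj C; y \<in> Obj C; u \<in> Cell (Hom C x y) 0\<rbrakk>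
       \<Longrightarrow> strict_nfunctor n (Hom C z x) (Hom C z y) (RWhisk C z x y u)"
    and whisk_agree:
      "\<lbrakk>x \<in> Obj C; y \<in> Obj C; z \<in> Obj C; u \<in> Cell (Hom C x y) 0; v \<in> Cell (Hom C y z) 0\<rbrakk>
       \<Longrightarrow> LWhisk C x y z u 0 v = RWhisk C x y z v 0 u"
    and unit_cell:
      "x \<in> Obj C \<Longrightarrow> Unit C x \<in> Cell (Hom C x x) 0"
    and unit_lwhisk:
      "\<lbrakk>x \<in> Obj C; y \<in> Obj C; k \<le> n; f \<in> Cell (Hom C x y) k\<rbrakk>
       \<Longrightarrow> LWhisk C x x y (Unit C x) k f = f"
    and unit_rwhisk:
      "\<lbrakk>x \<in> Obj C; y \<in> Obj C; k \<le> n; f \<in> Cell (Hom C x y) k\<rbrakk>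
       \<Longrightarrow> RWhisk C x y y (Unit C y) k f = f"
    and lwhisk_lwhisk:
      "\<lbrakk>w \<in> Obj C; x \<in> Obj C; y \<in> Obj C; z \<in> Obj C; u \<in> Cell (Hom C w x) 0;
        v \<in> Cell (Hom C x y) 0; k \<le> n; f \<in> Cell (Hom C y z) k\<rbrakk>
       \<Longrightarrow> LWhisk C w x z u k (LWhisk C x y z v k f)
           = LWhisk C w y z (LWhisk C w x y u 0 v) k f"
    and lwhisk_rwhisk:
      "\<lbrakk>w \<in> Obj C; x \<in> Obj C; y \<in> Obj C; z \<in> Obj C; u \<in> Cell (Hom C w x) 0;
        v \<in> Cell (Hom C y z) 0; k \<le> n; f \<in> Cell (Hom C x y) k\<rbrakk>
       \<Longrightarrow> LWhisk C w x z u k (RWhisk C x y z v k f)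
           = RWhisk C w y z v k (LWhisk C w x y u k f)"
    and rwhisk_rwhisk:
      "\<lbrakk>w \<in> Obj C; x \<in> Obj C; y \<in> Obj C; z \<in> Obj C; u \<in> Cell (Hom C x y) 0;
        v \<in> Cell (Hom C y z) 0; k \<le> n; f \<in> Cell (Hom C w x) k\<rbrakk>
       \<Longrightarrow> RWhisk C w x z (LWhisk C x y z u 0 v) k f
           = RWhisk C w y z v k (RWhisk C w x y u k f)"

text \<open>
  The 4-cells are the 3-cells of the hom-categories, and \<open>\<star>\<^sub>3\<close> is their 2-composition.
\<close>

locale white_category_4_3 = white_category 3 C
  for C :: "('o, 'a, 'r) white_cat_scheme" +
  assumes hom_invertible: "\<lbrakk>x \<in> Obj C; y \<in> Obj C\<rbrakk> \<Longrightarrow> invertible_cells 2 (Hom C x y)"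

text \<open>
  For \<open>k \<ge> 1\<close>, the k-cells of \<open>C\<close> form the disjoint union of the sets of (k-1)-cells of the
  hom-categories, whence the tagging with the 0-source and the 0-target.
\<close>

definition wcell :: "('o, 'a, 'r) white_cat_scheme \<Rightarrow> nat \<Rightarrow> ('o \<times> 'o \<times> 'a) set" where
  "wcell C k = {(x, y, f). x \<in> Obj C \<and> y \<in> Obj C \<and> f \<in> Cell (Hom C x y) (k - 1)}"

text \<open>\<open>wsrc C k m\<close> and \<open>wtgt C k m\<close>: k-source and k-target of an m-cell, \<open>1 \<le> k \<le> m\<close>.\<close>

definition wsrc ::
    "('o, 'a, 'r) white_cat_scheme \<Rightarrow> nat \<Rightarrow> nat \<Rightarrow> 'o \<times> 'o \<times> 'a \<Rightarrow> 'o \<times> 'o \<times> 'a" where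
  "wsrc C k m = (\<lambda>(x, y, f). (x, y, ksrc (Hom C x y) (k - 1) (m - 1) f))"

definition wtgt ::
    "('o, 'a, 'r) white_cat_scheme \<Rightarrow> nat \<Rightarrow> nat \<Rightarrow> 'o \<times> 'o \<times> 'a \<Rightarrow> 'o \<times> 'o \<times> 'a" where
  "wtgt C k m = (\<lambda>(x, y, f). (x, y, ktgt (Hom C x y) (k - 1) (m - 1) f))"

text \<open>The identity (k+1)-cell on a k-cell, \<open>k \<ge> 1\<close>.\<close>

definition wid ::
    "('o, 'a, 'r) white_cat_scheme \<Rightarrow> nat \<Rightarrow> 'o \<times> 'o \<times> 'a \<Rightarrow> 'o \<times> 'o \<times> 'a" where
  "wid C k = (\<lambda>(x, y, f). (x, y, Idn (Hom C x y) (k - 1) f))"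

text \<open>
  The composition \<open>\<star>\<^sub>k\<close> of m-cells, \<open>1 \<le> k < m\<close>; composable cells have the same 0-source and
  the same 0-target.
\<close>

definition wcomp ::
    "('o, 'a, 'r) white_cat_scheme \<Rightarrow> nat \<Rightarrow> nat
      \<Rightarrow> 'o \<times> 'o \<times> 'a \<Rightarrow> 'o \<times> 'o \<times> 'a \<Rightarrow> 'o \<times> 'o \<times> 'a" where
  "wcomp C k m = (\<lambda>(x, y, f) (_, _, g). (x, y, Comp (Hom C x y) (k - 1) (m - 1) f g))"


section \<open>Pointed white-categories and coherence\<close>

definition pointed_white_category ::
    "('o, 'a, 'r) white_cat_scheme \<Rightarrow> ('o \<times> 'o \<times> 'a) set \<Rightarrow> bool" where
  "pointed_white_category C S \<longleftrightarrow> white_category_4_3 C \<and> S \<subseteq> wcell C 2"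

fun restrict_cell ::
    "('o, 'a, 'r) white_cat_scheme \<Rightarrow> ('o \<times> 'o \<times> 'a) set \<Rightarrow> nat \<Rightarrow> ('o \<times> 'o \<times> 'a) set" where
  "restrict_cell C S 0 = S"
| "restrict_cell C S (Suc 0) = {A \<in> wcell C 3. wsrc C 2 3 A \<in> S \<and> wtgt C 2 3 A \<in> S}"
| "restrict_cell C S (Suc (Suc 0)) = {\<alpha> \<in> wcell C 4. wsrc C 2 4 \<alpha> \<in> S \<and> wtgt C 2 4 \<alpha> \<in> S}"
| "restrict_cell C S (Suc (Suc (Suc k))) = {}"

definition restriction ::
    "('o, 'a, 'r) white_cat_scheme \<Rightarrow> ('o \<times> 'o \<times> 'a) set \<Rightarrow> ('o \<times> 'o \<times> 'a) ncat" where
  "restriction C S =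
     \<lparr>Cell = restrict_cell C S,
      Src = \<lambda>k. wsrc C (k + 2) (k + 3),
      Tgt = \<lambda>k. wtgt C (k + 2) (k + 3),
      Idn = \<lambda>k. wid C (k + 2),
      Comp = \<lambda>k m. wcomp C (k + 2) (m + 2)\<rparr>"

definition parallel :: "('a, 'r) ncat_scheme \<Rightarrow> 'a \<Rightarrow> 'a \<Rightarrow> bool" where
  "parallel K A B \<longleftrightarrow> A \<in> Cell K 1 \<and> B \<in> Cell K 1 \<and> Src K 0 A = Src K 0 B \<and> Tgt K 0 A = Tgt K 0 B"

definition connected_by_2cell :: "('a, 'r) ncat_scheme \<Rightarrow> ('a \<times> 'a) set" where
  "connected_by_2cell K = {(A, B). \<exists>\<alpha> \<in> Cell K 2. Src K 1 \<alpha> = A \<and> Tgt K 1 \<alpha> = B}"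

definition coherent ::
    "('o, 'a, 'r) white_cat_scheme \<Rightarrow> ('o \<times> 'o \<times> 'a) set \<Rightarrow> bool" where
  "coherent C S \<longleftrightarrow>
     (\<forall>A B. parallel (restriction C S) A B \<longrightarrow> (A, B) \<in> connected_by_2cell (restriction C S))"


section \<open>Categories, quotients, and the relation of being stronger\<close>

record ('o, 'm) cat =
  Ob :: "'o set"
  Arr :: "'m set"
  Dom :: "'m \<Rightarrow> 'o"
  Cod :: "'m \<Rightarrow> 'o"
  Ide :: "'o \<Rightarrow> 'm"
  Cmp :: "'m \<Rightarrow> 'm \<Rightarrow> 'm"

locale category =
  fixes A :: "('o, 'm, 'r) cat_scheme"
  assumes dom_ob: "f \<in> Arr A \<Longrightarrow> Dom A f \<in> Ob A"
    and cod_ob: "f \<in> Arr A \<Longrightarrow> Cod A f \<in> Ob A"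
    and ide_arr: "x \<in> Ob A \<Longrightarrow> Ide A x \<in> Arr A"
    and dom_ide: "x \<in> Ob A \<Longrightarrow> Dom A (Ide A x) = x"
    and cod_ide: "x \<in> Ob A \<Longrightarrow> Cod A (Ide A x) = x"
    and cmp_arr: "\<lbrakk>f \<in> Arr A; g \<in> Arr A; Cod A f = Dom A g\<rbrakk> \<Longrightarrow> Cmp A f g \<in> Arr A"
    and dom_cmp: "\<lbrakk>f \<in> Arr A; g \<in> Arr A; Cod A f = Dom A g\<rbrakk> \<Longrightarrow> Dom A (Cmp A f g) = Dom A f"
    and cod_cmp: "\<lbrakk>f \<in> Arr A; g \<in> Arr A; Cod A f = Dom A g\<rbrakk> \<Longrightarrow> Cod A (Cmp A f g) = Cod A g"
    and cmp_ide_left: "f \<in> Arr A \<Longrightarrow> Cmp A (Ide A (Dom A f)) f = f"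
    and cmp_ide_right: "f \<in> Arr A \<Longrightarrow> Cmp A f (Ide A (Cod A f)) = f"
    and cmp_assoc: "\<lbrakk>f \<in> Arr A; g \<in> Arr A; h \<in> Arr A; Cod A f = Dom A g; Cod A g = Dom A h\<rbrakk>
          \<Longrightarrow> Cmp A (Cmp A f g) h = Cmp A f (Cmp A g h)"

definition hom_set :: "('o, 'm, 'r) cat_scheme \<Rightarrow> 'o \<Rightarrow> 'o \<Rightarrow> 'm set" where
  "hom_set A s t = {f \<in> Arr A. Dom A f = s \<and> Cod A f = t}"

locale category_functor = source: category A + target: category B
  for A :: "('o, 'm, 'r) cat_scheme" and B :: "('p, 'n, 's) cat_scheme" +
  fixes F0 :: "'o \<Rightarrow> 'p" and F1 :: "'m \<Rightarrow> 'n"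
  assumes map_ob: "x \<in> Ob A \<Longrightarrow> F0 x \<in> Ob B"
    and map_arr: "f \<in> Arr A \<Longrightarrow> F1 f \<in> Arr B"
    and map_dom: "f \<in> Arr A \<Longrightarrow> Dom B (F1 f) = F0 (Dom A f)"
    and map_cod: "f \<in> Arr A \<Longrightarrow> Cod B (F1 f) = F0 (Cod A f)"
    and map_ide: "x \<in> Ob A \<Longrightarrow> F1 (Ide A x) = Ide B (F0 x)"
    and map_cmp: "\<lbrakk>f \<in> Arr A; g \<in> Arr A; Cod A f = Dom A g\<rbrakk>
          \<Longrightarrow> F1 (Cmp A f g) = Cmp B (F1 f) (F1 g)"

definition zero_surjective ::
    "('o, 'm, 'r) cat_scheme \<Rightarrow> ('p, 'n, 's) cat_scheme \<Rightarrow> ('o \<Rightarrow> 'p) \<Rightarrow> bool" where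
  "zero_surjective A B F0 \<longleftrightarrow> F0 ` Ob A = Ob B"

definition one_surjective ::
    "('o, 'm, 'r) cat_scheme \<Rightarrow> ('p, 'n, 's) cat_scheme \<Rightarrow> ('o \<Rightarrow> 'p) \<Rightarrow> ('m \<Rightarrow> 'n) \<Rightarrow> bool" where
  "one_surjective A B F0 F1 \<longleftrightarrow>
     (\<forall>s \<in> Ob A. \<forall>t \<in> Ob A. F1 ` hom_set A s t = hom_set B (F0 s) (F0 t))"

text \<open>
  In a (2,1)-category, \<open>connected_by_2cell\<close> is an equivalence relation on 1-cells compatible with
  sources, targets and composition, so that the choices of representatives below are immaterial.
\<close>

definition quotient_category :: "('a, 'r) ncat_scheme \<Rightarrow> ('a, 'a set) cat" where
  "quotient_category K =
     \<lparr>Ob = Cell K 0,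
      Arr = Cell K 1 // connected_by_2cell K,
      Dom = \<lambda>X. the_elem (Src K 0 ` X),
      Cod = \<lambda>X. the_elem (Tgt K 0 ` X),
      Ide = \<lambda>x. connected_by_2cell K `` {Idn K 0 x},
      Cmp = \<lambda>X Y. \<Union>A \<in> X. \<Union>B \<in> Y. connected_by_2cell K `` {Comp K 0 1 A B}\<rparr>"

definition stronger ::
    "('p, 'b, 's) white_cat_scheme \<Rightarrow> ('p \<times> 'p \<times> 'b) set
      \<Rightarrow> ('o, 'a, 'r) white_cat_scheme \<Rightarrow> ('o \<times> 'o \<times> 'a) set \<Rightarrow> bool" where
  "stronger C' S' C S \<longleftrightarrow>
     (\<exists>F0 F1.
        category_functor (quotient_category (restriction C' S'))
          (quotient_category (restriction C S)) F0 F1 \<and>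
        zero_surjective (quotient_category (restriction C' S'))
          (quotient_category (restriction C S)) F0 \<and>
        one_surjective (quotient_category (restriction C' S'))
          (quotient_category (restriction C S)) F0 F1)"


section \<open>The restriction and its quotient are well defined\<close>

lemma restriction_two_one_category:
  assumes "pointed_white_category C S"
  shows "two_one_category (restriction C S)"
proof -
  interpret white_category_4_3 C
    using assms by (simp add: pointed_white_category_def)
  have S: "x \<in> Obj C \<and> y \<in> Obj C \<and> f \<in> Cell (Hom C x y) (Suc 0)" if "(x, y, f) \<in> S" for x y f
    using that assms by (auto simp: pointed_white_category_def wcell_def)
  let ?K = "restriction C S"
  have lt2: "k = 0 \<or> k = Suc 0" if "k < 2" for k :: nat
    using that by auto
  have pair: "(k = 0 \<and> m = Suc 0) \<or> (k = 0 \<and> m = 2) \<or> (k = Suc 0 \<and> m = 2)"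
    if "k < m" "m \<le> 2" for k m :: nat
    using that by auto
  have cell [simp]: "Cell ?K 0 = S"
    "(x, y, f) \<in> Cell ?K (Suc 0) \<longleftrightarrow> x \<in> Obj C \<and> y \<in> Obj C \<and> f \<in> Cell (Hom C x y) 2 \<and>
       (x, y, Src (Hom C x y) (Suc 0) f) \<in> S \<and> (x, y, Tgt (Hom C x y) (Suc 0) f) \<in> S"
    "(x, y, f) \<in> Cell ?K 2 \<longleftrightarrow> x \<in> Obj C \<and> y \<in> Obj C \<and> f \<in> Cell (Hom C x y) 3 \<and>
       (x, y, Src (Hom C x y) (Suc 0) (Src (Hom C x y) 2 f)) \<in> S \<and>
       (x, y, Tgt (Hom C x y) (Suc 0) (Tgt (Hom C x y) 2 f)) \<in> S" for x y f
    by (simp_all add: restriction_def wcell_def wsrc_def wtgt_def numeral_2_eq_2 numeral_3_eq_3 eval_nat_numeral)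
  have ops [simp]: 
    "Src ?K 0 (x, y, f) = (x, y, Src (Hom C x y) (Suc 0) f)"
    "Src ?K (Suc 0) (x, y, f) = (x, y, Src (Hom C x y) 2 f)"
    "Tgt ?K 0 (x, y, f) = (x, y, Tgt (Hom C x y) (Suc 0) f)"
    "Tgt ?K (Suc 0) (x, y, f) = (x, y, Tgt (Hom C x y) 2 f)"
    "Idn ?K 0 (x, y, f) = (x, y, Idn (Hom C x y) (Suc 0) f)"
    "Idn ?K (Suc 0) (x, y, f) = (x, y, Idn (Hom C x y) 2 f)"
    "Comp ?K 0 (Suc 0) (x, y, f) (x', y', g) = (x, y, Comp (Hom C x y) (Suc 0) 2 f g)"
    "Comp ?K 0 2 (x, y, f) (x', y', g) = (x, y, Comp (Hom C x y) (Suc 0) 3 f g)"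
    "Comp ?K (Suc 0) 2 (x, y, f) (x', y', g) = (x, y, Comp (Hom C x y) 2 3 f g)"
    for x y f x' y' g
    by (simp_all add: restriction_def wid_def wcomp_def wsrc_def wtgt_def numeral_2_eq_2 numeral_3_eq_3 eval_nat_numeral)
  have k [simp]: "ksrc L k (Suc k) f = Src L k f" "ktgt L k (Suc k) f = Tgt L k f"
    "kid L k (Suc k) f = Idn L k f" 
    "ksrc L 0 2 f = Src L 0 (Src L (Suc 0) f)" "ktgt L 0 2 f = Tgt L 0 (Tgt L (Suc 0) f)"
    "kid L 0 2 f = Idn L (Suc 0) (Idn L 0 f)"
    "ksrc L (Suc 0) 2 f = Src L (Suc 0) f" "ktgt L (Suc 0) 2 f = Tgt L (Suc 0) f"
    "kid L (Suc 0) 2 f = Idn L (Suc 0) f"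
    "ksrc L 2 3 f = Src L 2 f" "ktgt L 2 3 f = Tgt L 2 f" "kid L 2 3 f = Idn L 2 f"
    "ksrc L (Suc 0) 3 f = Src L (Suc 0) (Src L 2 f)" "ktgt L (Suc 0) 3 f = Tgt L (Suc 0) (Tgt L 2 f)"
    "kid L (Suc 0) 3 f = Idn L 2 (Idn L (Suc 0) f)"
    for L :: "('x, 'y) ncat_scheme" and k f
    apply (cases k; simp)+
    by (simp_all add: numeral_2_eq_2 numeral_3_eq_3)
  have [simp]: "Suc 2 = 3" by simp
  note H = strict_ncategory.src_cell[OF hom_category, of _ _ "Suc 0"]
    strict_ncategory.src_cell[OF hom_category, of _ _ "2"]
    strict_ncategory.tgt_cell[OF hom_category, of _ _ "Suc 0"]
    strict_ncategory.tgt_cell[OF hom_category, of _ _ "2"]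
    strict_ncategory.globular_src[OF hom_category, of _ _ "Suc 0"]
    strict_ncategory.globular_tgt[OF hom_category, of _ _ "Suc 0"]
    strict_ncategory.id_cell[OF hom_category, of _ _ "Suc 0"]
    strict_ncategory.id_cell[OF hom_category, of _ _ "2"]
    strict_ncategory.src_id[OF hom_category, of _ _ "Suc 0"]
    strict_ncategory.src_id[OF hom_category, of _ _ "2"]
    strict_ncategory.tgt_id[OF hom_category, of _ _ "Suc 0"]
    strict_ncategory.tgt_id[OF hom_category, of _ _ "2"]
    strict_ncategory.comp_cell[OF hom_category, of _ _ "Suc 0" 2]
    strict_ncategory.comp_cell[OF hom_category, of _ _ "Suc 0" 3]
    strict_ncategory.comp_cell[OF hom_category, of _ _ "2" 3]
    strict_ncategory.src_comp_top[OF hom_category, of _ _ "Suc 0"]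
    strict_ncategory.src_comp_top[OF hom_category, of _ _ "2"]
    strict_ncategory.tgt_comp_top[OF hom_category, of _ _ "Suc 0"]
    strict_ncategory.tgt_comp_top[OF hom_category, of _ _ "2"]
    strict_ncategory.src_comp[OF hom_category, of _ _ "Suc 0" 2]
    strict_ncategory.tgt_comp[OF hom_category, of _ _ "Suc 0" 2]
    strict_ncategory.comp_assoc[OF hom_category, of _ _ "Suc 0" 2]
    strict_ncategory.comp_assoc[OF hom_category, of _ _ "Suc 0" 3]
    strict_ncategory.comp_assoc[OF hom_category, of _ _ "2" 3]
    strict_ncategory.id_comp_left[OF hom_category, of _ _ "Suc 0" 2]
    strict_ncategory.id_comp_left[OF hom_category, of _ _ "Suc 0" 3]
    strict_ncategory.id_comp_left[OF hom_category, of _ _ "2" 3]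
    strict_ncategory.id_comp_right[OF hom_category, of _ _ "Suc 0" 2]
    strict_ncategory.id_comp_right[OF hom_category, of _ _ "Suc 0" 3]
    strict_ncategory.id_comp_right[OF hom_category, of _ _ "2" 3]
    strict_ncategory.interchange[OF hom_category, of _ _ "Suc 0" 2 3]
    strict_ncategory.id_comp[OF hom_category, of _ _ "Suc 0" 2]
  note H' [simp] = H[simplified composable_def k One_nat_def numeral_2_eq_2[symmetric], simplified]
  have two [simp]: "Suc (Suc 0) = 2" by simp
  have [simp]: "Comp (Hom C x y) (Suc 0) 3
      (Idn (Hom C x y) 2 (Idn (Hom C x y) (Suc 0) (Src (Hom C x y) (Suc 0) (Tgt (Hom C x y) 2 f)))) f = f"
    if "x \<in> Obj C" "y \<in> Obj C" "f \<in> Cell (Hom C x y) 3" for x y f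
    using strict_ncategory.id_comp_left[OF hom_category, of x y "Suc 0" 3 f] that by simp
  have "strict_ncategory 2 ?K"
    apply unfold_locales
    subgoal for k f using S[of "fst f" "fst (snd f)" "snd (snd f)"] by (cases f) (auto dest!: lt2)
    subgoal for k f using S[of "fst f" "fst (snd f)" "snd (snd f)"] by (cases f) (auto dest!: lt2)
    subgoal for k f by (cases f) auto
    subgoal for k f by (cases f) auto
    subgoal for k f using S[of "fst f" "fst (snd f)" "snd (snd f)"] by (cases f) (auto dest!: lt2)
    subgoal for k f using S[of "fst f" "fst (snd f)" "snd (snd f)"] by (cases f) (auto dest!: lt2)
    subgoal for k f using S[of "fst f" "fst (snd f)" "snd (snd f)"] by (cases f) (auto dest!: lt2)
    subgoal for k m f g by (cases f; cases g) (auto dest!: pair simp: composable_def)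
    subgoal for m f g by (cases f; cases g) (auto dest!: lt2 simp: composable_def)
    subgoal for m f g by (cases f; cases g) (auto dest!: lt2 simp: composable_def)
    subgoal for k m f g by (cases f; cases g) (auto dest!: lt2 simp: composable_def)
    subgoal for k m f g by (cases f; cases g) (auto dest!: lt2 simp: composable_def)
    subgoal for k m f g h by (cases f; cases g; cases h) (auto dest!: pair simp: composable_def)
    subgoal for k m f by (cases f) (auto dest!: pair simp: composable_def)
    subgoal for k m f by (cases f) (auto dest!: pair simp: composable_def)
    subgoal for j k m f g f' g' by (cases f; cases g; cases f'; cases g') (auto dest!: pair simp: composable_def)
    subgoal for k m f g by (cases f; cases g) (auto dest!: lt2 simp: composable_def)
    done
  moreover have "invertible_cells 1 ?K"
    using hom_invertible
    apply (auto simp: invertible_cells_def)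
    subgoal premises p for x y f
    proof -
      obtain g where "g \<in> Cell (Hom C x y) 3" "Src (Hom C x y) 2 g = Tgt (Hom C x y) 2 f"
        "Tgt (Hom C x y) 2 g = Src (Hom C x y) 2 f"
        "Comp (Hom C x y) 2 3 f g = Idn (Hom C x y) 2 (Src (Hom C x y) 2 f)"
        "Comp (Hom C x y) 2 3 g f = Idn (Hom C x y) 2 (Tgt (Hom C x y) 2 f)"
        using p by blast
      then show ?thesis using p by (intro bexI[of _ "(x, y, g)"]) auto
    qed
    done
  ultimately show ?thesis by (simp add: two_one_category_def)
qed

lemma quotient_is_category:
  assumes "two_one_category K"
  shows "equiv (Cell K 1) (connected_by_2cell K)" "category (quotient_category K)"
proof -
  interpret strict_ncategory 2 K using assms by (simp add: two_one_category_def)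
  have inv: "invertible_cells 1 K" using assms by (simp add: two_one_category_def)
  let ?R = "connected_by_2cell K"
  have k: "ksrc K 0 (Suc 0) f = Src K 0 f" "ktgt K 0 (Suc 0) f = Tgt K 0 f"
    "kid K 0 (Suc 0) f = Idn K 0 f"
    "ksrc K 0 2 f = Src K 0 (Src K (Suc 0) f)" "ktgt K 0 2 f = Tgt K 0 (Tgt K (Suc 0) f)"
    "ksrc K (Suc 0) 2 f = Src K (Suc 0) f" "ktgt K (Suc 0) 2 f = Tgt K (Suc 0) f" for f
    by (simp_all add: numeral_2_eq_2)
  have two: "Suc (Suc 0) = 2" by simp
  note simps = composable_def k two
  note c1 = comp_cell[of 0 "Suc 0", simplified simps, simplified]
  note c2 = comp_cell[of "Suc 0" 2, simplified simps, simplified]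
  note c02 = comp_cell[of 0 2, simplified simps, simplified]
  note st = src_comp_top[of "Suc 0", simplified simps, simplified]
    tgt_comp_top[of "Suc 0", simplified simps, simplified]
    src_comp_top[of 0, simplified simps, simplified]
    tgt_comp_top[of 0, simplified simps, simplified]
    src_comp[of 0 "Suc 0", simplified simps, simplified]
    tgt_comp[of 0 "Suc 0", simplified simps, simplified]
  note as = comp_assoc[of 0 "Suc 0", simplified simps, simplified]
  note idl = id_comp_left[of 0 "Suc 0", simplified simps, simplified]
    id_comp_right[of 0 "Suc 0", simplified simps, simplified]
  note cells = src_cell[of 0, simplified] tgt_cell[of 0, simplified]
    src_cell[of "Suc 0", simplified two, simplified] tgt_cell[of "Suc 0", simplified two, simplified]
  note glob = globular_src[of 0, simplified two, simplified]  globular_tgt[of 0, simplified two, simplified] 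
  note ids = id_cell[of 0, simplified] src_id[of 0, simplified] tgt_id[of 0, simplified]
     id_cell[of "Suc 0", simplified two, simplified] src_id[of "Suc 0", simplified] tgt_id[of "Suc 0", simplified]
  have R: "(A, B) \<in> ?R \<longleftrightarrow> (\<exists>\<alpha> \<in> Cell K 2. Src K (Suc 0) \<alpha> = A \<and> Tgt K (Suc 0) \<alpha> = B)" for A B
    by (simp add: connected_by_2cell_def)
  have Rcell: "A \<in> Cell K (Suc 0) \<and> B \<in> Cell K (Suc 0) \<and> Src K 0 A = Src K 0 B \<and> Tgt K 0 A = Tgt K 0 B"
    if "(A, B) \<in> ?R" for A B
    using that by (auto simp: R cells glob)
  have refl: "(A, A) \<in> ?R" if "A \<in> Cell K (Suc 0)" for A
    unfolding R using that ids(4-6) by blast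
  have sym: "(B, A) \<in> ?R" if AB: "(A, B) \<in> ?R" for A B
  proof -
    obtain a where a: "a \<in> Cell K 2" "Src K (Suc 0) a = A" "Tgt K (Suc 0) a = B"
      using AB unfolding R by auto
    then obtain b where "b \<in> Cell K 2" "Src K (Suc 0) b = B" "Tgt K (Suc 0) b = A"
      using inv unfolding invertible_cells_def One_nat_def two by blast
    then show ?thesis unfolding R by blast
  qed
  have trans: "(A, D) \<in> ?R" if AB: "(A, B) \<in> ?R" and BD: "(B, D) \<in> ?R" for A B D
  proof -
    obtain a b where a: "a \<in> Cell K 2" "Src K (Suc 0) a = A" "Tgt K (Suc 0) a = B"
      and b: "b \<in> Cell K 2" "Src K (Suc 0) b = B" "Tgt K (Suc 0) b = D"
      using AB BD unfolding R by auto
    then have "Comp K (Suc 0) 2 a b \<in> Cell K 2" "Src K (Suc 0) (Comp K (Suc 0) 2 a b) = A"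
      "Tgt K (Suc 0) (Comp K (Suc 0) 2 a b) = D"
      by (simp_all add: c2 st(1,2))
    then show ?thesis unfolding R by blast
  qed
  show eq: "equiv (Cell K 1) ?R"
    by (rule equivI) (auto simp: refl_on_def sym_on_def trans_on_def intro: refl sym trans dest: Rcell)
  have comp: "(Comp K 0 (Suc 0) A B, Comp K 0 (Suc 0) A' B') \<in> ?R"
    if AA': "(A, A') \<in> ?R" and BB': "(B, B') \<in> ?R" and AB: "Tgt K 0 A = Src K 0 B" for A A' B B'
  proof -
    obtain a b where a: "a \<in> Cell K 2" "Src K (Suc 0) a = A" "Tgt K (Suc 0) a = A'"
      and b: "b \<in> Cell K 2" "Src K (Suc 0) b = B" "Tgt K (Suc 0) b = B'"
      using AA' BB' unfolding R by auto
    have t: "Tgt K 0 (Tgt K (Suc 0) a) = Src K 0 (Src K (Suc 0) b)"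
      using a b AB Rcell[OF AA'] by simp
    have "Comp K 0 2 a b \<in> Cell K 2" "Src K (Suc 0) (Comp K 0 2 a b) = Comp K 0 (Suc 0) A B"
      "Tgt K (Suc 0) (Comp K 0 2 a b) = Comp K 0 (Suc 0) A' B'"
      using c02[of a b] st(5,6)[of a b] a b t by simp_all
    then show ?thesis unfolding R by blast
  qed
  have cls: "\<exists>A. X = ?R `` {A} \<and> A \<in> Cell K (Suc 0)" if "X \<in> Cell K (Suc 0) // ?R" for X
    using that by (auto simp: quotient_def)
  have dom: "the_elem (Src K 0 ` (?R `` {A})) = Src K 0 A" 
    and cod: "the_elem (Tgt K 0 ` (?R `` {A})) = Tgt K 0 A" if "A \<in> Cell K (Suc 0)" for A
  proof -
    have "Src K 0 ` (?R `` {A}) = {Src K 0 A}" "Tgt K 0 ` (?R `` {A}) = {Tgt K 0 A}"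
      using refl[OF that] by (auto dest: Rcell intro!: rev_image_eqI[of A])
    then show "the_elem (Src K 0 ` (?R `` {A})) = Src K 0 A" "the_elem (Tgt K 0 ` (?R `` {A})) = Tgt K 0 A"
      by simp_all
  qed
  have cmp: "(\<Union>A \<in> ?R `` {A}. \<Union>B \<in> ?R `` {B}. ?R `` {Comp K 0 (Suc 0) A B}) = ?R `` {Comp K 0 (Suc 0) A B}"
    if "A \<in> Cell K (Suc 0)" "B \<in> Cell K (Suc 0)" "Tgt K 0 A = Src K 0 B" for A B
  proof
    show "(\<Union>A \<in> ?R `` {A}. \<Union>B \<in> ?R `` {B}. ?R `` {Comp K 0 (Suc 0) A B}) \<subseteq> ?R `` {Comp K 0 (Suc 0) A B}"
    proof
      fix D assume "D \<in> (\<Union>A \<in> ?R `` {A}. \<Union>B \<in> ?R `` {B}. ?R `` {Comp K 0 (Suc 0) A B})"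
      then obtain A' B' where "(A, A') \<in> ?R" "(B, B') \<in> ?R" "(Comp K 0 (Suc 0) A' B', D) \<in> ?R"
        by auto
      then show "D \<in> ?R `` {Comp K 0 (Suc 0) A B}"
        using trans[OF comp[OF _ _ that(3)]] by simp
    qed
    show "?R `` {Comp K 0 (Suc 0) A B} \<subseteq> (\<Union>A \<in> ?R `` {A}. \<Union>B \<in> ?R `` {B}. ?R `` {Comp K 0 (Suc 0) A B})"
      using refl[OF that(1)] refl[OF that(2)] by (intro subsetI UN_I[of A] UN_I[of B]) simp_all
  qed
  have cell: "?R `` {A} \<in> Cell K (Suc 0) // ?R" if "A \<in> Cell K (Suc 0)" for A
    using that by (rule quotientI)
  define q where "q A = ?R `` {A}" for A
  let ?Q = "quotient_category K"
  have arr: "X \<in> Arr ?Q \<longleftrightarrow> (\<exists>A \<in> Cell K (Suc 0). X = q A)" for X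
    using cls cell by (auto simp: quotient_category_def q_def)
  have ops: "Ob ?Q = Cell K 0" "Ide ?Q x = q (Idn K 0 x)" for x
    by (simp_all add: quotient_category_def q_def)
  have ops': "Dom ?Q (q A) = Src K 0 A" "Cod ?Q (q A) = Tgt K 0 A" if "A \<in> Cell K (Suc 0)" for A
    using dom[OF that] cod[OF that] by (simp_all add: quotient_category_def q_def)
  have ops'': "Cmp ?Q (q A) (q B) = q (Comp K 0 (Suc 0) A B)"
    if "A \<in> Cell K (Suc 0)" "B \<in> Cell K (Suc 0)" "Tgt K 0 A = Src K 0 B" for A B
    using cmp[OF that] by (simp add: quotient_category_def q_def)
  show "category ?Q"
    by unfold_locales (auto simp: arr ops ops' ops'' cells ids c1 st as idl)
qed

end

theory Submission
  imports Defs
begin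

text \<open>
  A pointed white-category is coherent iff the category obtained from its restriction by
  identifying connected 1-cells is thin, i.e. its hom-sets have at most one element. Thinness
  passes along a functor that is surjective on objects and on hom-sets.
\<close>

definition thin :: "('o, 'm, 'r) cat_scheme \<Rightarrow> bool" where
  "thin A \<longleftrightarrow> (\<forall>s \<in> Ob A. \<forall>t \<in> Ob A. \<forall>f \<in> hom_set A s t. \<forall>g \<in> hom_set A s t. f = g)"

text \<open>Two arrows with the same endpoints lift to arrows between the same chosen preimages of
  those endpoints, where thinness of \<open>A\<close> forces the lifts to agree.\<close>

lemma thin_image:
  assumes "thin A" "zero_surjective A B F0" "one_surjective A B F0 F1"
  shows "thin B"
  unfolding thin_def
proof (intro ballI)
  fix s t f g
  assume "s \<in> Ob B" "t \<in> Ob B" and fg: "f \<in> hom_set B s t" "g \<in> hom_set B s t"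
  then obtain s' t' where st': "s' \<in> Ob A" "t' \<in> Ob A" "s = F0 s'" "t = F0 t'"
    using assms(2) unfolding zero_surjective_def by (metis imageE)
  then have "F1 ` hom_set A s' t' = hom_set B s t"
    using assms(3) by (simp add: one_surjective_def)
  then obtain f' g' where f'g': "f' \<in> hom_set A s' t'" "g' \<in> hom_set A s' t'"
    and F1: "f = F1 f'" "g = F1 g'"
    using fg by blast
  have "f' = g'"
    using assms(1) st'(1,2) f'g' by (simp add: thin_def)
  then show "f = g"
    using F1 by simp
qed

text \<open>This is globularity of the connecting 2-cell, one dimension below its boundary.\<close>

lemma connected_by_2cell_parallel:
  assumes "strict_ncategory 2 K" "(A, B) \<in> connected_by_2cell K"
  shows "parallel K A B"
proof -
  interpret strict_ncategory 2 K by fact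
  obtain \<alpha> where "\<alpha> \<in> Cell K 2" "Src K 1 \<alpha> = A" "Tgt K 1 \<alpha> = B"
    using assms(2) by (auto simp: connected_by_2cell_def)
  then show ?thesis
    using src_cell[of 1 \<alpha>] tgt_cell[of 1 \<alpha>] globular_src[of 0 \<alpha>] globular_tgt[of 0 \<alpha>]
    by (auto simp: parallel_def numeral_2_eq_2)
qed

text \<open>\<open>Dom\<close> and \<open>Cod\<close> are given by \<open>the_elem\<close>, so the
  image of a class under \<open>Src K 0\<close> or \<open>Tgt K 0\<close> must be a singleton: it is
  nonempty because the class contains \<open>A\<close>, and constant because connected 1-cells are
  parallel.\<close>

lemma quotient_category_dom_cod:
  assumes "two_one_category K" "A \<in> Cell K 1"
  shows "Dom (quotient_category K) (connected_by_2cell K `` {A}) = Src K 0 A"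
    and "Cod (quotient_category K) (connected_by_2cell K `` {A}) = Tgt K 0 A"
proof -
  have "A \<in> connected_by_2cell K `` {A}"
    using quotient_is_category(1)[OF assms(1)] assms(2) by (rule equiv_class_self)
  moreover have "Src K 0 B = Src K 0 A \<and> Tgt K 0 B = Tgt K 0 A"
    if "B \<in> connected_by_2cell K `` {A}" for B
    using connected_by_2cell_parallel[of K A B] that assms(1)
    by (simp add: two_one_category_def parallel_def)
  ultimately have "Src K 0 ` (connected_by_2cell K `` {A}) = {Src K 0 A}"
    "Tgt K 0 ` (connected_by_2cell K `` {A}) = {Tgt K 0 A}"
    by blast+
  then show "Dom (quotient_category K) (connected_by_2cell K `` {A}) = Src K 0 A"
    "Cod (quotient_category K) (connected_by_2cell K `` {A}) = Tgt K 0 A"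
    by (simp_all add: quotient_category_def)
qed

text \<open>The arrows of one hom-set of the quotient are the classes of mutually parallel 1-cells,
  and two classes are equal exactly when their representatives are connected.\<close>

lemma thin_quotient_category_iff:
  assumes "two_one_category K"
  shows "thin (quotient_category K)
    \<longleftrightarrow> (\<forall>A B. parallel K A B \<longrightarrow> (A, B) \<in> connected_by_2cell K)"
    (is "thin ?Q \<longleftrightarrow> (\<forall>A B. _ \<longrightarrow> _ \<in> ?R)")
proof
  note dom_cod = quotient_category_dom_cod[OF assms]
  note eq = quotient_is_category(1)[OF assms]
  show "\<forall>A B. parallel K A B \<longrightarrow> (A, B) \<in> ?R" if "thin ?Q"
  proof (intro allI impI)
    fix A B assume AB: "parallel K A B"
    then have cells: "A \<in> Cell K 1" "B \<in> Cell K 1"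
      by (simp_all add: parallel_def)
    then have "?R `` {A} \<in> hom_set ?Q (Src K 0 A) (Tgt K 0 A)"
      "?R `` {B} \<in> hom_set ?Q (Src K 0 A) (Tgt K 0 A)"
      using AB dom_cod by (auto simp: hom_set_def parallel_def quotient_category_def intro: quotientI)
    \<comment> \<open>\<open>thin\<close> quantifies over objects only, so the common endpoints have
      to be recognised as 0-cells.\<close>
    moreover have "Src K 0 A \<in> Ob ?Q" "Tgt K 0 A \<in> Ob ?Q"
      using assms cells strict_ncategory.src_cell[of 2 K 0 A] strict_ncategory.tgt_cell[of 2 K 0 A]
      by (simp_all add: two_one_category_def quotient_category_def)
    ultimately have "?R `` {A} = ?R `` {B}"
      using that unfolding thin_def by blast
    \<comment> \<open>Equal classes yield related elements because \<open>B\<close> lies in the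
      carrier \<open>Cell K 1\<close> of the equivalence.\<close>
    then show "(A, B) \<in> ?R"
      using eq_equiv_class eq cells(2) by metis
  qed
  show "thin ?Q" if "\<forall>A B. parallel K A B \<longrightarrow> (A, B) \<in> ?R"
    unfolding thin_def
  proof (intro ballI)
    fix s t X Y assume XY: "X \<in> hom_set ?Q s t" "Y \<in> hom_set ?Q s t"
    then obtain A B where AB: "X = ?R `` {A}" "A \<in> Cell K 1" "Y = ?R `` {B}" "B \<in> Cell K 1"
      by (auto simp: hom_set_def quotient_category_def elim!: quotientE)
    then have "parallel K A B"
      using XY dom_cod by (auto simp: hom_set_def parallel_def)
    then show "X = Y"
      using that AB equiv_class_eq[OF eq] by blast
  qed
qed

text \<open>Being pointed makes the restriction a (2,1)-category, to which the preceding equivalence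
  applies.\<close>

lemma coherent_iff_thin:
  assumes "pointed_white_category C S"
  shows "coherent C S \<longleftrightarrow> thin (quotient_category (restriction C S))"
  using thin_quotient_category_iff[OF restriction_two_one_category[OF assms]]
  by (simp add: coherent_def)

theorem lemma2p2p8:
  fixes C :: "('o, 'a) white_cat" and S :: "('o \<times> 'o \<times> 'a) set"
    and C' :: "('p, 'b) white_cat" and S' :: "('p \<times> 'p \<times> 'b) set"
  assumes "pointed_white_category C S"
    and "pointed_white_category C' S'"
    and "stronger C' S' C S"
    and "coherent C' S'"
  shows "coherent C S"
  using assms thin_image unfolding stronger_def by (metis coherent_iff_thin)

end
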